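(* Let $0<\lambda\le 1$ and let $f\in\mathcal{G}(\lambda)$. Then for $|z|=r<1$: (i) $(1-r)^{\lambda}\le |f'(z)|\le (1+r)^{\lambda}$; (ii) $|\arg\{f'(z)\}|\le \lambda\sin^{-1}r$; (iii) $-\mathbf{G}_{F_\lambda}(-r)=\dfrac{1-(1-r)^{\lambda+1}}{1+\lambda}\le |f(z)|\le \dfrac{(1+r)^{\lambda+1}-1}{1+\lambda}=\mathbf{G}_{F_\lambda}(r)$. These inequalities are sharp; equalities hold for $f(z)=\mathbf{G}_{F_\lambda}(z)$ or its rotations.
   Context: $\mathbb{D}=\{z\in\mathbb{C}:|z|<1\}$. $\mathcal{A}$ is the class of holomorphic functions in $\mathbb{D}$ of the form $f(z)=z+\sum_{n\ge 2}a_nz^n$. For $0<\lambda\le 1$, $\mathcal{G}(\lambda)$ is the class of locally univalent functions $f\in\mathcal{A}$ (i.e. $f'\neq 0$ in $\mathbb{D}$) such that $\Re\left(1+zf''(z)/f'(z)\right)<1+\lambda/2$ for all $z\in\mathbb{D}$. $\mathbf{G}_{F_\lambda}(z)=\frac{(1+z)^{1+\lambda}-1}{1+\lambda}$, with the branch of the power equal to $1$ at $z=0$. A rotation of a function $f$ is a function $\overline{\mu}f(\mu z)$ with $|\mu|=1$. $\arg\{f'(z)\}$ is the continuous branch with value $0$ at $z=0$. That equalities hold for a function means that, for each $r$, each bound is attained by it at some point of $|z|=r$. *)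

theory Defs
  imports "HOL-Complex_Analysis.Complex_Analysis"
begin

abbreviation unit_disc :: "complex set" ("\<bbbD>") where
  "\<bbbD> \<equiv> ball 0 1"

definition class_A :: "(complex \<Rightarrow> complex) set" where
  "class_A = {f. f holomorphic_on \<bbbD> \<and>
     (\<exists>a :: nat \<Rightarrow> complex. \<forall>z\<in>\<bbbD>. (\<lambda>n. a (n + 2) * z ^ (n + 2)) sums (f z - z))}"

definition class_G :: "real \<Rightarrow> (complex \<Rightarrow> complex) set" where
  "class_G lam = {f \<in> class_A.
     (\<forall>z\<in>\<bbbD>. deriv f z \<noteq> 0) \<and>
     (\<forall>z\<in>\<bbbD>. Re (1 + z * deriv (deriv f) z / deriv f z) < 1 + lam / 2)}"

(* powr is the principal branch: holomorphic in z on the disc, with value 1 at z = 0 *)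
definition G_F :: "real \<Rightarrow> complex \<Rightarrow> complex" where
  "G_F lam z = ((1 + z) powr complex_of_real (1 + lam) - 1) / complex_of_real (1 + lam)"

definition rotation :: "complex \<Rightarrow> (complex \<Rightarrow> complex) \<Rightarrow> complex \<Rightarrow> complex" where
  "rotation \<mu> f z = cnj \<mu> * f (\<mu> * z)"

definition is_arg_branch :: "(complex \<Rightarrow> complex) \<Rightarrow> (complex \<Rightarrow> real) \<Rightarrow> bool" where
  "is_arg_branch g \<theta> \<longleftrightarrow> continuous_on \<bbbD> \<theta> \<and> \<theta> 0 = 0 \<and>
     (\<forall>z\<in>\<bbbD>. g z = complex_of_real (norm (g z)) * cis (\<theta> z))"

(* On the disc the choice is unique (arg_branch_eq) for zero-free g, and a branch exists whenever
   g is continuous and zero-free with g 0 = 1 (is_arg_branch_arg_branch). Meaningless elsewhere. *)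
definition arg_branch :: "(complex \<Rightarrow> complex) \<Rightarrow> complex \<Rightarrow> real" where
  "arg_branch g = (SOME \<theta>. is_arg_branch g \<theta>)"

lemma is_arg_branch_unique:
  assumes "is_arg_branch g \<theta>" "is_arg_branch g \<phi>" "\<And>z. z \<in> \<bbbD> \<Longrightarrow> g z \<noteq> 0" "z \<in> \<bbbD>"
  shows "\<theta> z = \<phi> z"
proof -
  let ?d = "\<lambda>z. (\<theta> z - \<phi> z) / (2 * pi)"
  have int: "?d w \<in> \<int>" if "w \<in> \<bbbD>" for w
  proof -
    have "cis (\<theta> w) = cis (\<phi> w)"
      using assms(1-3) that unfolding is_arg_branch_def
      by (metis mult_cancel_left norm_eq_zero of_real_eq_0_iff)
    then have "sin (\<theta> w) = sin (\<phi> w) \<and> cos (\<theta> w) = cos (\<phi> w)"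
      by (simp add: cis.code)
    then obtain n :: int where "\<theta> w = \<phi> w + 2 * pi * n"
      using sin_cos_eq_iff by auto
    then have "?d w = of_int n"
      by simp
    then show ?thesis
      by (metis Ints_of_int)
  qed
  have "?d constant_on \<bbbD>"
  proof (rule continuous_discrete_range_constant)
    show "continuous_on \<bbbD> ?d"
      using assms(1,2) unfolding is_arg_branch_def by (auto intro!: continuous_intros)
    show "\<exists>e>0. \<forall>y. y \<in> \<bbbD> \<and> ?d y \<noteq> ?d x \<longrightarrow> e \<le> norm (?d y - ?d x)" if x: "x \<in> \<bbbD>" for x
    proof (intro exI[of _ 1] conjI allI impI)
      fix y assume y: "y \<in> \<bbbD> \<and> ?d y \<noteq> ?d x"
      then have "?d y - ?d x \<in> \<int>" "?d y - ?d x \<noteq> 0"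
        using int[of y] int[OF x] by (blast intro: Ints_diff, simp)
      then show "1 \<le> norm (?d y - ?d x)"
        unfolding real_norm_def by (rule Ints_nonzero_abs_ge1)
    qed simp
  qed simp
  then have "?d z = ?d 0"
    using assms(4) unfolding constant_on_def by (metis centre_in_ball zero_less_one)
  then show ?thesis
    using assms(1,2) by (simp add: is_arg_branch_def)
qed

lemma is_arg_branch_arg_branch:
  assumes "continuous_on \<bbbD> g" "\<And>z. z \<in> \<bbbD> \<Longrightarrow> g z \<noteq> 0" "g 0 = 1"
  shows "is_arg_branch g (arg_branch g)"
proof -
  obtain h where h: "continuous_on \<bbbD> h" "\<And>z. z \<in> \<bbbD> \<Longrightarrow> g z = exp (h z)"
    using continuous_logarithm_on_ball assms(1,2) by metis
  have h0: "exp (h 0) = 1"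
    using h(2)[of 0] assms(3) by simp
  have "is_arg_branch g (\<lambda>z. Im (h z - h 0))"
    unfolding is_arg_branch_def
  proof (intro conjI ballI)
    show "continuous_on \<bbbD> (\<lambda>z. Im (h z - h 0))"
      using h(1) by (intro continuous_intros)
    fix z :: complex assume z: "z \<in> \<bbbD>"
    have "exp (h z - h 0) = exp (h z)"
      by (simp add: exp_diff h0)
    then have "g z = exp (h z - h 0)"
      using h(2)[OF z] by simp
    then show "g z = complex_of_real (norm (g z)) * cis (Im (h z - h 0))"
      by (metis exp_eq_polar norm_exp_eq_Re)
  qed simp
  then show ?thesis
    unfolding arg_branch_def by (rule someI[of "is_arg_branch g"])
qed

lemma arg_branch_eq:
  assumes "is_arg_branch g \<theta>" "\<And>z. z \<in> \<bbbD> \<Longrightarrow> g z \<noteq> 0" "z \<in> \<bbbD>"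
  shows "arg_branch g z = \<theta> z"
  using is_arg_branch_unique[OF _ assms] someI[of "is_arg_branch g", OF assms(1)]
  unfolding arg_branch_def by blast

end

theory Submission
  imports Defs
begin

text \<open>
  The class condition forces \<^term>\<open>deriv f\<close> to be subordinate to the derivative
  \<open>(1 + z)\<^sup>\<lambda>\<close> of the extremal function, and everything else is read off from this.

  Since \<open>f'\<close> has no zeros, it can be written \<open>f' = h\<^sup>\<lambda>\<close> with \<open>h\<close> holomorphic and \<open>h 0 = 1\<close>. The
  condition then becomes \<open>Re (z h' / h) < 1/2\<close>. If \<open>w = h - 1\<close> left the unit disc, then at a point
  of smallest modulus with \<open>\<bar>w\<bar> = 1\<close>, Jack's lemma would give \<open>z w' = k w\<close> with \<open>k \<ge> 1\<close>; as
  \<open>Re (w / (1 + w)) = 1/2\<close> whenever \<open>\<bar>w\<bar> = 1\<close> and \<open>w \<noteq> -1\<close>, this would force \<open>Re (z h' / h) \<ge> 1/2\<close>.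
  So \<open>w\<close> maps the disc into itself and the Schwarz lemma sharpens this to \<open>\<bar>h z - 1\<bar> \<le> \<bar>z\<bar>\<close>
  (\<open>class_G_representation\<close>). Thus \<open>h z\<close> lies in a disc around 1 inside the right half-plane, of which
  the modulus and the argument are controlled, and raising to the power \<open>\<lambda>\<close> gives the bounds for the
  modulus and the argument of \<open>f'\<close>.

  The upper bound for \<open>\<bar>f\<bar>\<close> follows by integrating the one for \<open>\<bar>f'\<bar>\<close> along a radius. For the lower
  bound, an estimate of \<open>\<bar>f'\<bar>\<close> would not suffice without knowing that \<open>f\<close> is univalent and
  lifting a segment through it.
  For \<open>\<lambda> \<le> 1\<close> there is a shortcut: the real part of \<open>f'\<close> itself is at least \<open>(1 - \<bar>z\<bar>)\<^sup>\<lambda>\<close>, because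
  \<open>Re (u\<^sup>\<lambda>) \<ge> (Re u)\<^sup>\<lambda>\<close> in the right half-plane (\<open>Re_powr_le_Re_of_powr\<close>). Real parts may be
  integrated along the radius, and \<open>\<bar>f z\<bar> \<ge> Re (f z / e)\<close> for the direction \<open>e = z / \<bar>z\<bar>\<close>.

  For sharpness, the extremal function is the case \<open>h z = 1 + z\<close>; a rotation only turns the argument,
  so the bounds are attained at the rotated points \<open>\<plusminus>r\<close>, and the one for the argument where
  \<open>1 + z\<close>, before the rotation, is the point at which a ray from the origin touches the circle of
  radius \<open>r\<close> around 1.
\<close>

section \<open>Jack's lemma\<close>

text \<open>
  The core of Jack's lemma after normalising the boundary point and the value there to 1. Along the
  unit circle \<open>Re F\<close> has a maximum at 1, so its tangential derivative \<open>- Im q\<close> vanishes; along the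
  radius, \<open>Re (F t) - t\<close> is at most 0, with equality at the end point \<open>t = 1\<close>, so its derivative
  \<open>Re q - 1\<close> there is nonnegative.
\<close>
lemma boundary_critical_point_real:
  fixes F :: "complex \<Rightarrow> complex"
  assumes der: "(F has_field_derivative q) (at 1)" and F1: "F 1 = 1"
    and le: "\<And>z. norm z \<le> 1 \<Longrightarrow> norm (F z) \<le> norm z"
  shows "Im q = 0" and "1 \<le> Re q"
proof -
  have cis: "((\<lambda>t. cis t) has_vector_derivative \<i>) (at 0)"
    using has_derivative_cis[of "\<lambda>t. t" id 0 UNIV] 
    unfolding has_vector_derivative_def by (auto simp: id_def scaleR_conv_of_real mult.commute)
  have "((\<lambda>t. Re (F (cis t))) has_field_derivative Re (\<i> * q)) (at 0)"
    using has_field_derivative_Re[OF field_vector_diff_chain_at[OF cis, of F q]] der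
    by (simp add: o_def)
  moreover have "\<forall>t. \<bar>0 - t\<bar> < 1 \<longrightarrow> Re (F (cis t)) \<le> Re (F (cis 0))"
  proof (intro allI impI)
    fix t :: real
    have "Re (F (cis t)) \<le> norm (F (cis t))" by (rule complex_Re_le_cmod)
    also have "\<dots> \<le> 1" using le[of "cis t"] by simp
    finally show "Re (F (cis t)) \<le> Re (F (cis 0))" using F1 by simp
  qed
  ultimately have "Re (\<i> * q) = 0"
    by (rule DERIV_local_max[OF _ zero_less_one])
  then show "Im q = 0" by simp
  have dv: "((\<lambda>t. F (of_real t)) has_vector_derivative q) (at 1)"
    using has_vector_derivative_real_field[of F q 1 UNIV] der by simp
  have d: "((\<lambda>t. Re (F (of_real t)) - t) has_field_derivative (Re q - 1)) (at 1)"
    by (intro derivative_intros has_field_derivative_Re[OF dv])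
  show "1 \<le> Re q"
  proof (rule ccontr)
    assume "\<not> 1 \<le> Re q"
    then obtain d where d0: "d > 0" and
      *: "\<And>h. 0 < h \<Longrightarrow> h < d \<Longrightarrow> Re (F (of_real 1)) - 1 < Re (F (of_real (1 - h))) - (1 - h)"
      using DERIV_neg_dec_left[OF d] by auto
    define h where "h = min (d / 2) (1 / 2)"
    have h: "0 < h" "h < d" "h \<le> 1/2" using d0 by (auto simp: h_def)
    have "Re (F (of_real (1 - h))) \<le> norm (F (of_real (1 - h)))" by (rule complex_Re_le_cmod)
    also have "\<dots> \<le> 1 - h" using le[of "of_real (1 - h)"] h
      unfolding norm_of_real by simp
    finally show False using *[OF h(1,2)] F1 by simp
  qed
qed

text \<open>
  Rescaling by \<open>F \<zeta> = cnj (w z0) * w (\<zeta> * z0)\<close> moves the boundary point to 1. The Schwarz lemma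
  for \<open>F\<close> gives \<open>\<bar>F \<zeta>\<bar> \<le> \<bar>\<zeta>\<bar>\<close>, which is what makes the factor \<open>k\<close> at least 1 rather than
  merely nonnegative.
\<close>
lemma Jack_lemma:
  fixes w :: "complex \<Rightarrow> complex"
  assumes hol: "w holomorphic_on ball 0 1" and w0: "w 0 = 0"
    and z0: "norm z0 < 1" and wz0: "norm (w z0) = 1"
    and less: "\<And>z. norm z < norm z0 \<Longrightarrow> norm (w z) < 1"
  obtains k :: real where "1 \<le> k" "z0 * deriv w z0 = of_real k * w z0"
proof -
  have z0_nz: "z0 \<noteq> 0" using w0 wz0 by auto
  define F where "F = (\<lambda>\<zeta>. cnj (w z0) * w (\<zeta> * z0))"
  define q where "q = cnj (w z0) * (z0 * deriv w z0)"
  have cc: "cnj (w z0) * w z0 = 1"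
    using wz0 complex_norm_square[of "w z0"] by (simp add: mult.commute)
  have dw: "(w has_field_derivative deriv w z0) (at (1 * z0))"
    using holomorphic_derivI[OF hol open_ball, of z0] z0 by simp
  have der: "(F has_field_derivative q) (at 1)"
    unfolding F_def q_def
    using DERIV_cmult[OF DERIV_chain2[where g = "\<lambda>\<zeta>. \<zeta> * z0" and x = 1, OF dw],
        of z0 UNIV "cnj (w z0)"] DERIV_cmult_right[OF DERIV_ident, of z0 1]
    by (simp add: mult_ac)
  have ball: "norm (w (\<zeta> * z0)) \<le> norm \<zeta>" if "norm \<zeta> < 1" for \<zeta>
  proof (rule Schwarz_Lemma(1)[of "\<lambda>\<zeta>. w (\<zeta> * z0)"])
    have "(\<lambda>\<zeta>. \<zeta> * z0) ` ball 0 1 \<subseteq> ball 0 1"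
      using z0 by (auto simp: norm_mult intro!: le_less_trans[OF mult_right_le_one_le])
    then have "(w \<circ> (\<lambda>\<zeta>. \<zeta> * z0)) holomorphic_on ball 0 1"
      by (intro holomorphic_on_compose_gen[OF _ hol] holomorphic_intros) auto
    then show "(\<lambda>\<zeta>. w (\<zeta> * z0)) holomorphic_on ball 0 1" by (simp add: o_def)
    show "norm (w (\<zeta> * z0)) < 1" if "norm \<zeta> < 1" for \<zeta>
      using that z0_nz by (intro less) (simp add: norm_mult)
  qed (use that w0 in auto)
  have F_less: "norm (F \<zeta>) \<le> norm \<zeta>" if "norm \<zeta> < 1" for \<zeta>
    using ball[OF that] wz0 by (simp add: F_def norm_mult)
  \<comment> \<open>The circle itself is needed for the tangential derivative; it is reached by radial limits.\<close>
  have F_le: "norm (F \<zeta>) \<le> norm \<zeta>" if "norm \<zeta> \<le> 1" for \<zeta>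
  proof (cases "norm \<zeta> < 1")
    case False
    with that have n1: "norm \<zeta> = 1" by simp
    have "isCont w (\<zeta> * z0)"
      using hol z0 n1 by (intro holomorphic_on_imp_continuous_on[THEN continuous_on_interior]) (auto simp: norm_mult)
    then have c: "((\<lambda>t::real. norm (F (of_real t * \<zeta>))) \<longlongrightarrow> norm (F (of_real 1 * \<zeta>))) (at_left 1)"
      unfolding F_def
      by (intro tendsto_intros isCont_tendsto_compose[of _ w]) (auto intro!: tendsto_eq_intros)
    have "eventually (\<lambda>t::real. norm (F (of_real t * \<zeta>)) \<le> 1) (at_left 1)"
      using eventually_at_left_real[OF zero_less_one]
    proof eventually_elim
      case (elim t)
      then show ?case using F_less[of "of_real t * \<zeta>"] n1 by (simp add: norm_mult)
    qed
    from tendsto_upperbound[OF c this] show ?thesis using n1 by simp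
  qed (rule F_less)
  have F1: "F 1 = 1" by (simp add: F_def cc)
  note bd = boundary_critical_point_real[OF der F1 F_le]
  have q: "q = of_real (Re q)" using bd(1) by (simp add: complex_eq_iff)
  have "z0 * deriv w z0 = q * w z0"
    using cc by (simp add: q_def algebra_simps)
  then have "z0 * deriv w z0 = of_real (Re q) * w z0" by (subst (asm) q)
  with bd(2) show thesis by (intro that[of "Re q"])
qed

text \<open>
  The form in which Jack's lemma is applied: excluding the points that it would produce yields the
  Schwarz bound for functions not known in advance to map the disc into itself.
\<close>
lemma Schwarz_of_no_Jack_point:
  fixes w :: "complex \<Rightarrow> complex"
  assumes hol: "w holomorphic_on ball 0 1" and w0: "w 0 = 0"
    and none: "\<And>z k::real. \<lbrakk>norm z < 1; norm (w z) = 1; 1 \<le> k; z * deriv w z = of_real k * w z\<rbrakk> \<Longrightarrow> False"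
    and z: "norm z < 1"
  shows "norm (w z) \<le> norm z"
proof -
  have cont: "continuous_on (ball 0 1) w" by (rule holomorphic_on_imp_continuous_on[OF hol])
  have "norm (w z) < 1" if z: "norm z < 1" for z
  proof (rule ccontr)
    assume ge: "\<not> norm (w z) < 1"
    define K where "K = cball 0 (norm z) \<inter> (\<lambda>u. norm (w u)) -` {1..}"
    have "continuous_on (cball 0 (norm z)) (\<lambda>u. norm (w u))"
      by (intro continuous_intros continuous_on_subset[OF cont]) (use z in auto)
    then have "closed K"
      unfolding K_def by (intro continuous_closed_preimage) auto
    then have "compact K"
      by (auto simp: K_def compact_eq_bounded_closed intro: bounded_subset[OF bounded_cball])
    moreover have "K \<noteq> {}" using ge by (auto simp: K_def)
    ultimately obtain z0 where z0: "z0 \<in> K" and min: "\<And>u. u \<in> K \<Longrightarrow> norm z0 \<le> norm u"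
      using continuous_attains_inf[of K norm] by (auto intro: continuous_intros)
    have z0z: "norm z0 \<le> norm z" and wz0: "1 \<le> norm (w z0)" using z0 by (auto simp: K_def)
    have less: "norm (w u) < 1" if "norm u < norm z0" for u
      using min[of u] that z0z by (force simp: K_def)
    \<comment> \<open>The minimal point only satisfies \<open>\<bar>w z0\<bar> \<ge> 1\<close>; the value 1 is taken somewhere on the segment
      from 0 to it, which by minimality must be at the same modulus.\<close>
    have "\<exists>t\<ge>0. t \<le> 1 \<and> norm (w (of_real t * z0)) = 1"
    proof (rule IVT')
      show "continuous_on {0..1} (\<lambda>t. norm (w (of_real t * z0)))"
      proof (intro continuous_intros continuous_on_compose2[OF cont])
        show "(\<lambda>t. complex_of_real t * z0) ` {0..1} \<subseteq> ball 0 1"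
          using z z0z by (auto simp: norm_mult intro!: le_less_trans[OF mult_left_le_one_le, of "norm z0"])
      qed
    qed (use w0 wz0 in auto)
    then obtain t where t: "0 \<le> t" "t \<le> 1" and wt: "norm (w (of_real t * z0)) = 1" by blast
    have "norm (of_real t * z0) \<le> norm z0" using t by (simp add: norm_mult mult_left_le_one_le)
    then have "norm (of_real t * z0) = norm z0"
      using less[of "of_real t * z0"] wt by force
    then have less': "norm (w u) < 1" if "norm u < norm (of_real t * z0)" for u
      using less that by simp
    have lt1: "norm (of_real t * z0) < 1"
      using \<open>norm (of_real t * z0) \<le> norm z0\<close> z0z z by linarith
    obtain k where "1 \<le> k" "of_real t * z0 * deriv w (of_real t * z0) = of_real k * w (of_real t * z0)"
      using Jack_lemma[OF hol w0 lt1 wt less'] by blast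
    then show False by (rule none[OF lt1 wt])
  qed
  then show ?thesis
    by (intro Schwarz_Lemma(1)[OF hol w0 _ z])
qed

section \<open>Normalised functions and their rotations\<close>

text \<open>
  Dividing the series by \<open>z\<close> shows that \<open>f z / z\<close> tends to 1,
  and conversely a normalised holomorphic function has its Taylor series.
\<close>
lemma class_A_iff:
  "f \<in> class_A \<longleftrightarrow> f holomorphic_on \<bbbD> \<and> f 0 = 0 \<and> deriv f 0 = 1"
proof (intro iffI conjI)
  assume "f \<in> class_A"
  then obtain a where hol: "f holomorphic_on \<bbbD>" and
    a: "\<And>z. z \<in> \<bbbD> \<Longrightarrow> (\<lambda>n. a (n + 2) * z ^ (n + 2)) sums (f z - z)"
    unfolding class_A_def by blast
  show "f holomorphic_on \<bbbD>" by fact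
  have "(\<lambda>n. 0) sums f 0" using a[of 0] by simp
  then show f0: "f 0 = 0" using sums_unique2[OF sums_zero] by metis
  define b where "b n = (if n = 0 then 1 else a (n + 1))" for n
  have "(\<lambda>n. b n * z ^ n) sums (f z / z)" if "z \<noteq> 0" "norm z < 1" for z
  proof -
    have "(\<lambda>n. a (n + 2) * z ^ (n + 2) / z) sums ((f z - z) / z)"
      using a[of z] that by (intro sums_divide) simp
    then have "(\<lambda>n. b (Suc n) * z ^ Suc n) sums (f z / z - 1)"
      using that by (simp add: b_def diff_divide_distrib)
    then show ?thesis
      by (subst (asm) sums_Suc_iff) (simp add: b_def)
  qed
  then have "((\<lambda>z. f z / z) \<longlongrightarrow> b 0) (at 0)"
    by (rule powser_limit_0_strong[OF zero_less_one])
  then have "(f has_field_derivative 1) (at 0)"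
    by (simp add: DERIV_def b_def f0)
  then show "deriv f 0 = 1" by (rule DERIV_imp_deriv)
next
  assume f: "f holomorphic_on \<bbbD> \<and> f 0 = 0 \<and> deriv f 0 = 1"
  define a where "a n = (deriv ^^ n) f 0 / fact n" for n
  have "(\<lambda>n. a (n + 2) * z ^ (n + 2)) sums (f z - z)" if "z \<in> \<bbbD>" for z
  proof -
    have "(\<lambda>n. a n * z ^ n) sums f z"
      using holomorphic_power_series[of f 0 1 z] f that by (simp add: a_def)
    then show ?thesis
      using sums_split_initial_segment[of "\<lambda>n. a n * z ^ n" "f z" 2] f
      by (simp add: a_def numeral_2_eq_2)
  qed
  then show "f \<in> class_A" unfolding class_A_def using f by blast
qed

text \<open>
  The factor \<open>cnj \<mu>\<close> cancels the inner derivative, so that \<open>f'\<close> and \<open>z f'' / f'\<close> are just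
  precomposed with the rotation \<open>z \<mapsto> \<mu> z\<close> of the disc.
\<close>
lemma rotation_in_class_G:
  assumes f: "f \<in> class_G lam" and \<mu>: "norm \<mu> = 1"
  shows "rotation \<mu> f \<in> class_G lam"
    and "\<And>z. z \<in> \<bbbD> \<Longrightarrow> deriv (rotation \<mu> f) z = deriv f (\<mu> * z)"
proof -
  have hol: "f holomorphic_on \<bbbD>" and f0: "f 0 = 0" and f1: "deriv f 0 = 1"
    using f by (auto simp: class_G_def class_A_iff)
  have cc: "cnj \<mu> * \<mu> = 1"
    using \<mu> complex_norm_square[of \<mu>] by (simp add: mult.commute)
  have D: "\<mu> * z \<in> \<bbbD>" if "z \<in> \<bbbD>" for z using that \<mu> by (simp add: norm_mult)
  have d1: "(rotation \<mu> f has_field_derivative deriv f (\<mu> * z)) (at z)" if "z \<in> \<bbbD>" for z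
  proof -
    have "(f has_field_derivative deriv f (\<mu> * z)) (at (\<mu> * z))"
      by (rule holomorphic_derivI[OF hol open_ball D[OF that]])
    from DERIV_cmult[OF DERIV_chain2[OF this DERIV_cmult_Id[of \<mu>]], of "cnj \<mu>"]
    have "(rotation \<mu> f has_field_derivative cnj \<mu> * (deriv f (\<mu> * z) * \<mu>)) (at z)"
      by (simp add: rotation_def[abs_def])
    also have "cnj \<mu> * (deriv f (\<mu> * z) * \<mu>) = deriv f (\<mu> * z)"
      using cc by algebra
    finally show ?thesis .
  qed
  then show d1': "\<And>z. z \<in> \<bbbD> \<Longrightarrow> deriv (rotation \<mu> f) z = deriv f (\<mu> * z)"
    by (simp add: DERIV_imp_deriv)
  have d2: "deriv (deriv (rotation \<mu> f)) z = \<mu> * deriv (deriv f) (\<mu> * z)" if "z \<in> \<bbbD>" for z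
  proof -
    have "(deriv f has_field_derivative deriv (deriv f) (\<mu> * z)) (at (\<mu> * z))"
      by (rule holomorphic_derivI[OF holomorphic_deriv[OF hol open_ball] open_ball D[OF that]])
    from DERIV_chain2[OF this DERIV_cmult_Id[of \<mu>]]
    have "((\<lambda>z. deriv f (\<mu> * z)) has_field_derivative \<mu> * deriv (deriv f) (\<mu> * z)) (at z)"
      by (simp add: mult_ac)
    then have "(deriv (rotation \<mu> f) has_field_derivative \<mu> * deriv (deriv f) (\<mu> * z)) (at z)"
      by (rule has_field_derivative_transform_within_open[OF _ open_ball that]) (simp add: d1')
    then show ?thesis by (rule DERIV_imp_deriv)
  qed
  have "rotation \<mu> f holomorphic_on \<bbbD>"
    using d1 by (subst holomorphic_on_open) blast+
  moreover have "rotation \<mu> f 0 = 0" by (simp add: rotation_def f0)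
  moreover have "deriv (rotation \<mu> f) 0 = 1" using d1'[of 0] f1 by simp
  moreover have "deriv (rotation \<mu> f) z \<noteq> 0" if "z \<in> \<bbbD>" for z
    using f D[OF that] d1'[OF that] by (simp add: class_G_def)
  moreover have "Re (1 + z * deriv (deriv (rotation \<mu> f)) z / deriv (rotation \<mu> f) z) < 1 + lam / 2"
    if "z \<in> \<bbbD>" for z
  proof -
    have "Re (1 + (\<mu> * z) * deriv (deriv f) (\<mu> * z) / deriv f (\<mu> * z)) < 1 + lam / 2"
      using f D[OF that] unfolding class_G_def by blast
    then show ?thesis by (simp add: d1'[OF that] d2[OF that] mult_ac)
  qed
  ultimately show "rotation \<mu> f \<in> class_G lam"
    unfolding class_G_def class_A_iff by blast
qed

section \<open>Powers in the right half-plane\<close>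

lemma one_minus_le_Re:
  assumes "norm (u - 1) \<le> r"
  shows "1 - r \<le> Re u"
  using abs_Re_le_cmod[of "u - 1"] assms by simp

text \<open>
  With \<open>u = s (cos \<alpha> + i sin \<alpha>)\<close>,
  \<open>\<bar>u - 1\<bar>\<^sup>2 = (s - cos \<alpha>)\<^sup>2 + (sin \<alpha>)\<^sup>2\<close>, that is, \<open>\<bar>sin \<alpha>\<bar>\<close> is the distance from 1 to the ray
  through \<open>u\<close>.
\<close>
lemma abs_Im_Ln_le_arcsin:
  assumes u: "norm (u - 1) \<le> r" and r: "r < 1"
  shows "\<bar>Im (Ln u)\<bar> \<le> arcsin r"
proof -
  define \<alpha> where "\<alpha> = Im (Ln u)"
  define s where "s = norm u"
  have r0: "0 \<le> r" using u norm_ge_zero order_trans by blast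
  have Re: "0 < Re u" using one_minus_le_Re[OF u] r by simp
  then have u0: "u \<noteq> 0" and s: "0 < s" by (auto simp: s_def)
  have \<alpha>: "\<bar>\<alpha>\<bar> < pi / 2" using Re_Ln_pos_lt_imp[OF Re] by (simp add: \<alpha>_def)
  have "u = of_real s * cis \<alpha>"
    using exp_Ln[OF u0] u0 unfolding exp_eq_polar s_def \<alpha>_def by simp
  from arg_cong[OF this, of Re] arg_cong[OF this, of Im]
  have sc: "Re u = s * cos \<alpha>" "Im u = s * sin \<alpha>" by simp_all
  have "(norm (u - 1))\<^sup>2 \<le> r\<^sup>2" using u by (intro power_mono) auto
  then have "(s * cos \<alpha> - 1)\<^sup>2 + (s * sin \<alpha>)\<^sup>2 \<le> r\<^sup>2"
    by (simp add: cmod_power2 sc)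
  moreover have "(s * cos \<alpha> - 1)\<^sup>2 + (s * sin \<alpha>)\<^sup>2 = (s - cos \<alpha>)\<^sup>2 + (sin \<alpha>)\<^sup>2"
    using sin_cos_squared_add[of \<alpha>] by algebra
  ultimately have "(sin \<alpha>)\<^sup>2 \<le> r\<^sup>2" by (smt (verit) zero_le_power2)
  then have "\<bar>sin \<alpha>\<bar> \<le> r" using r0 by (simp add: abs_le_square_iff[symmetric])
  moreover have "sin \<bar>\<alpha>\<bar> = \<bar>sin \<alpha>\<bar>"
  proof (cases "\<alpha> \<ge> 0")
    case True
    then show ?thesis using sin_ge_zero[of \<alpha>] \<alpha> by simp
  next
    case False
    then show ?thesis using sin_ge_zero[of "-\<alpha>"] \<alpha> by simp
  qed
  ultimately show ?thesis
    using le_arcsin_iff[of r "\<bar>\<alpha>\<bar>"] r r0 \<alpha> by (simp add: \<alpha>_def)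
qed

text \<open>
  This is the concavity of \<open>ln \<circ> cos\<close> between 0 and \<open>x\<close>; it is obtained from the monotonicity of
  \<open>tan\<close>, since \<open>ln (cos (l x)) - l ln (cos x)\<close> vanishes at 0 and has derivative \<open>l (tan x - tan (l x))\<close>.
\<close>
lemma cos_powr_le_cos_mult:
  assumes x: "\<bar>x\<bar> < pi / 2" and l: "0 \<le> l" "l \<le> 1"
  shows "cos x powr l \<le> cos (l * x)"
proof -
  have *: "cos x powr l \<le> cos (l * x)" if x: "0 \<le> x" "x < pi / 2" for x
  proof -
    have le: "0 \<le> l * y" "l * y \<le> y" if "0 \<le> y" for y
      using l that mult_left_le_one_le[of y l] by auto
    have cp: "0 < cos y" "0 < cos (l * y)" if "0 \<le> y" "y \<le> x" for y
      using that x le[of y] by (auto intro!: cos_gt_zero_pi)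
    define \<phi> where "\<phi> y = ln (cos (l * y)) - l * ln (cos y)" for y
    have "\<phi> 0 \<le> \<phi> x"
    proof (rule DERIV_nonneg_imp_nondecreasing[OF x(1)])
      fix y assume y: "0 \<le> y" "y \<le> x"
      have "(\<phi> has_real_derivative l * (tan y - tan (l * y))) (at y)"
        unfolding \<phi>_def using cp[OF y]
        by (auto intro!: derivative_eq_intros simp: tan_def field_simps)
      moreover have "tan (l * y) \<le> tan y"
        using le[of y] y x by (subst tan_mono_le_eq) auto
      ultimately show "\<exists>d. (\<phi> has_real_derivative d) (at y) \<and> 0 \<le> d"
        using l by (auto intro!: exI[of _ "l * (tan y - tan (l * y))"])
    qed
    then have "l * ln (cos x) \<le> ln (cos (l * x))" by (simp add: \<phi>_def)
    then have "exp (l * ln (cos x)) \<le> cos (l * x)"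
      using cp[OF x(1)] by (metis exp_le_cancel_iff exp_ln order_refl)
    then show ?thesis using cp(1)[OF x(1)] by (simp add: powr_def)
  qed
  show ?thesis
  proof (cases "x \<ge> 0")
    case True then show ?thesis using * x by simp
  next
    case False then show ?thesis using *[of "-x"] x by simp
  qed
qed

text \<open>
  In polar form \<open>u = s (cos \<alpha> + i sin \<alpha>)\<close> this compares \<open>s\<^sup>l (cos \<alpha>)\<^sup>l\<close> with \<open>s\<^sup>l cos (l \<alpha>)\<close>.
\<close>
lemma Re_powr_le_Re_of_powr:
  assumes u: "0 < Re u" and l: "0 \<le> l" "l \<le> 1"
  shows "Re u powr l \<le> Re (u powr complex_of_real l)"
proof -
  define \<alpha> where "\<alpha> = Im (Ln u)"
  have u0: "u \<noteq> 0" using u by auto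
  have \<alpha>: "\<bar>\<alpha>\<bar> < pi / 2" using Re_Ln_pos_lt_imp[OF u] by (simp add: \<alpha>_def)
  have "u = of_real (norm u) * cis \<alpha>"
    using exp_Ln[OF u0] u0 unfolding exp_eq_polar \<alpha>_def by simp
  from arg_cong[OF this, of Re] have "Re u = norm u * cos \<alpha>" by simp
  then have "Re u powr l = norm u powr l * cos \<alpha> powr l"
    using \<alpha> by (simp add: powr_mult cos_gt_zero_pi less_imp_le)
  also have "\<dots> \<le> norm u powr l * cos (l * \<alpha>)"
    by (intro mult_left_mono cos_powr_le_cos_mult \<alpha> l) auto
  also have "\<dots> = Re (u powr complex_of_real l)"
    using u0 by (simp add: powr_def Re_exp \<alpha>_def)
  finally show ?thesis .
qed

text \<open>
  As long as \<open>h\<close> stays in the right half-plane, the principal logarithm of \<open>h\<close> is continuous, and so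
  it describes the continuous argument of a power of \<open>h\<close> even where that power leaves the half-plane.
\<close>
lemma arg_branch_powr:
  assumes cont: "continuous_on \<bbbD> h" and h0: "h 0 = 1"
    and Re: "\<And>z. z \<in> \<bbbD> \<Longrightarrow> 0 < Re (h z)"
    and g: "\<And>z. z \<in> \<bbbD> \<Longrightarrow> g z = h z powr complex_of_real l"
    and z: "z \<in> \<bbbD>"
  shows "arg_branch g z = l * Im (Ln (h z))"
proof (rule arg_branch_eq[OF _ _ z])
  have nz: "h z \<noteq> 0" if "z \<in> \<bbbD>" for z using Re[OF that] by auto
  show "g z \<noteq> 0" if "z \<in> \<bbbD>" for z using nz that by (simp add: g)
  show "is_arg_branch g (\<lambda>z. l * Im (Ln (h z)))"
    unfolding is_arg_branch_def
  proof (intro conjI ballI)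
    show "continuous_on \<bbbD> (\<lambda>z. l * Im (Ln (h z)))"
      by (intro continuous_intros cont) (use Re in \<open>force simp: complex_nonpos_Reals_iff\<close>)
    show "l * Im (Ln (h 0)) = 0" by (simp add: h0)
    fix z :: complex assume z: "z \<in> \<bbbD>"
    have "g z = exp (of_real l * Ln (h z))" using nz[OF z] by (simp add: g[OF z] powr_def)
    then show "g z = complex_of_real (norm (g z)) * cis (l * Im (Ln (h z)))"
      by (simp add: exp_eq_polar[of "of_real l * Ln (h z)"] norm_mult)
  qed
qed

section \<open>Subordination and bounds for the derivative\<close>

text \<open>
  The subordination \<open>f' \<prec> (1 + z)\<^sup>\<lambda>\<close>, with \<open>h - 1\<close> as the Schwarz function. The power is a principal
  one, although \<open>h\<close> is constructed as \<open>exp (L / \<lambda>)\<close> from a holomorphic logarithm \<open>L\<close> of \<open>f'\<close>.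
\<close>
lemma class_G_representation:
  assumes lam: "0 < lam" and f: "f \<in> class_G lam"
  obtains h where "h holomorphic_on \<bbbD>" "h 0 = 1"
    "\<And>z. z \<in> \<bbbD> \<Longrightarrow> norm (h z - 1) \<le> norm z"
    "\<And>z. z \<in> \<bbbD> \<Longrightarrow> deriv f z = h z powr complex_of_real lam"
proof -
  have hol: "f holomorphic_on \<bbbD>" and f1: "deriv f 0 = 1"
    and nz: "\<And>z. z \<in> \<bbbD> \<Longrightarrow> deriv f z \<noteq> 0"
    and Re: "\<And>z. z \<in> \<bbbD> \<Longrightarrow> Re (z * deriv (deriv f) z / deriv f z) < lam / 2"
    using f by (auto simp: class_G_def class_A_iff)
  have hol': "deriv f holomorphic_on \<bbbD>" by (intro holomorphic_deriv hol open_ball)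
  obtain M where M: "M holomorphic_on \<bbbD>" and eM: "\<And>z. z \<in> \<bbbD> \<Longrightarrow> exp (M z) = deriv f z"
    using holomorphic_logarithm_exists[OF convex_ball open_ball hol' nz, of 0] by auto
  define L where "L z = M z - M 0" for z
  have L: "L holomorphic_on \<bbbD>" unfolding L_def by (intro holomorphic_intros M)
  have L0: "L 0 = 0" by (simp add: L_def)
  have eL: "deriv f z = exp (L z)" if "z \<in> \<bbbD>" for z
    using eM[OF that] eM[of 0] f1 by (simp add: L_def exp_diff)
  define h where "h z = exp (L z / of_real lam)" for z
  have h: "h holomorphic_on \<bbbD>" unfolding h_def using lam by (intro holomorphic_intros L) auto
  have h0: "h 0 = 1" by (simp add: h_def L0)
  have le: "norm (h z - 1) \<le> norm z" if "z \<in> \<bbbD>" for z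
  proof (rule Schwarz_of_no_Jack_point[of "\<lambda>z. h z - 1"])
    show "(\<lambda>z. h z - 1) holomorphic_on ball 0 1" by (intro holomorphic_intros h)
    fix z :: complex and k :: real
    assume z: "norm z < 1" and w1: "norm (h z - 1) = 1" and k: "1 \<le> k"
      and Jack: "z * deriv (\<lambda>z. h z - 1) z = of_real k * (h z - 1)"
    have zD: "z \<in> \<bbbD>" using z by simp
    have hz: "h z \<noteq> 0" by (simp add: h_def)
    have dL: "(L has_field_derivative deriv L z) (at z)"
      by (rule holomorphic_derivI[OF L open_ball zD])
    have "((\<lambda>z. exp (L z)) has_field_derivative exp (L z) * deriv L z) (at z)"
      by (rule DERIV_chain2[OF DERIV_exp dL])
    then have "(deriv f has_field_derivative exp (L z) * deriv L z) (at z)"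
      by (rule has_field_derivative_transform_within_open[OF _ open_ball zD]) (simp add: eL)
    then have "deriv (deriv f) z = deriv f z * deriv L z"
      by (simp add: DERIV_imp_deriv eL[OF zD])
    then have ReL: "Re (z * deriv L z) < lam / 2"
      using Re[OF zD] nz[OF zD] by simp
    have "((\<lambda>z. h z - 1) has_field_derivative h z * (deriv L z / of_real lam)) (at z)"
      unfolding h_def using lam by (auto intro!: derivative_eq_intros dL)
    then have "z * (h z * (deriv L z / of_real lam)) = of_real k * (h z - 1)"
      using Jack by (simp add: DERIV_imp_deriv)
    then have zL: "z * deriv L z = of_real (lam * k) * ((h z - 1) / h z)"
      using hz lam by (simp add: field_simps)
    \<comment> \<open>The circle \<open>\<bar>u - 1\<bar> = 1\<close> without 0 is mapped by \<open>u \<mapsto> (u - 1) / u\<close> onto the line \<open>Re = 1/2\<close>.\<close>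
    have half: "Re ((h z - 1) / h z) = 1 / 2"
    proof -
      have "(Re (h z) - 1)\<^sup>2 + (Im (h z))\<^sup>2 = 1"
        using w1 by (metis cmod_power2 minus_complex.sel one_complex.sel power_one diff_zero)
      then have e: "(Re (h z))\<^sup>2 + (Im (h z))\<^sup>2 = 2 * Re (h z)" by (simp add: power2_diff)
      moreover have "Re (h z) \<noteq> 0"
      proof
        assume "Re (h z) = 0"
        with e hz show False by (auto simp: complex_eq_iff)
      qed
      ultimately show ?thesis using hz
        by (simp add: diff_divide_distrib Re_divide)
    qed
    have "Re (z * deriv L z) = lam * k * (1 / 2)"
      unfolding zL using half by (simp only: Re_complex_of_real times_complex.sel Im_complex_of_real mult_zero_left diff_zero)
    moreover have "lam * 1 \<le> lam * k" using k lam by (intro mult_left_mono) auto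
    ultimately show False using ReL by simp
  qed (use that in \<open>auto simp: h0\<close>)
  have Reh: "0 < Re (h z)" if "z \<in> \<bbbD>" for z
    using one_minus_le_Re[OF le[OF that]] that by simp
  \<comment> \<open>\<open>L / lam\<close> is a logarithm of \<open>h\<close>; that it is the principal one follows because both imaginary
    parts are continuous branches of the argument of \<open>h\<close> vanishing at 0.\<close>
  have Ln_h: "Ln (h z) = L z / of_real lam" if z: "z \<in> \<bbbD>" for z
  proof (rule complex_eqI)
    show "Re (Ln (h z)) = Re (L z / of_real lam)" by (simp add: h_def)
    have "is_arg_branch h (\<lambda>z. Im (L z / of_real lam))"
      unfolding is_arg_branch_def
    proof (intro conjI ballI)
      show "continuous_on \<bbbD> (\<lambda>z. Im (L z / of_real lam))"
        using lam by (intro continuous_intros holomorphic_on_imp_continuous_on[OF L]) auto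
      show "Im (L 0 / of_real lam) = 0" by (simp add: L0)
      show "h z = complex_of_real (norm (h z)) * cis (Im (L z / of_real lam))" for z
        by (simp add: h_def exp_eq_polar[of "L z / of_real lam"] norm_mult)
    qed
    then have "arg_branch h z = Im (L z / of_real lam)"
      by (rule arg_branch_eq[OF _ _ z]) (simp add: h_def)
    moreover have "arg_branch h z = 1 * Im (Ln (h z))"
    proof (rule arg_branch_powr[OF holomorphic_on_imp_continuous_on[OF h] h0 Reh _ z])
      show "h z = h z powr complex_of_real 1" for z by (simp add: h_def)
    qed
    ultimately show "Im (Ln (h z)) = Im (L z / of_real lam)" by simp
  qed
  have "deriv f z = h z powr complex_of_real lam" if "z \<in> \<bbbD>" for z
    using Ln_h[OF that] lam by (simp add: powr_def eL[OF that]) (simp add: h_def)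
  with that h h0 le show thesis by blast
qed

text \<open>
  The lower bound is stated for the real part instead of the modulus: it is stronger, and it is the
  form that survives integration along a radius.
\<close>
lemma class_G_deriv_bounds:
  assumes lam: "0 < lam" "lam \<le> 1" and f: "f \<in> class_G lam" and z: "norm z < 1"
  shows "(1 - norm z) powr lam \<le> Re (deriv f z)"
    and "norm (deriv f z) \<le> (1 + norm z) powr lam"
    and "\<bar>arg_branch (deriv f) z\<bar> \<le> lam * arcsin (norm z)"
proof -
  obtain h where h: "h holomorphic_on \<bbbD>" and h0: "h 0 = 1"
    and le: "\<And>z. z \<in> \<bbbD> \<Longrightarrow> norm (h z - 1) \<le> norm z"
    and df: "\<And>z. z \<in> \<bbbD> \<Longrightarrow> deriv f z = h z powr complex_of_real lam"
    using class_G_representation[OF lam(1) f] by metis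
  have zD: "z \<in> \<bbbD>" using z by simp
  have Re: "1 - norm z \<le> Re (h z)" if "z \<in> \<bbbD>" for z by (rule one_minus_le_Re[OF le[OF that]])
  have "(1 - norm z) powr lam \<le> Re (h z) powr lam"
    using Re[OF zD] z lam by (intro powr_mono2) auto
  also have "\<dots> \<le> Re (deriv f z)"
    unfolding df[OF zD] using Re[OF zD] z lam by (intro Re_powr_le_Re_of_powr) auto
  finally show "(1 - norm z) powr lam \<le> Re (deriv f z)" .
  have "norm (h z) \<le> 1 + norm z"
    using norm_triangle_ineq[of "h z - 1" 1] le[OF zD] by simp
  then show "norm (deriv f z) \<le> (1 + norm z) powr lam"
    using lam by (simp add: df[OF zD] norm_powr_real_powr' powr_mono2)
  have "arg_branch (deriv f) z = lam * Im (Ln (h z))"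
  proof (rule arg_branch_powr[OF holomorphic_on_imp_continuous_on[OF h] h0 _ df zD])
    show "0 < Re (h z)" if "z \<in> \<bbbD>" for z using Re[OF that] that by simp
  qed
  then show "\<bar>arg_branch (deriv f) z\<bar> \<le> lam * arcsin (norm z)"
    using abs_Im_Ln_le_arcsin[OF le[OF zD] z] lam by (simp add: abs_mult)
qed

section \<open>Bounds for the function\<close>

text \<open>
  Both bounds integrate the derivative bounds along the segment from 0 to \<open>z\<close>. The upper bound uses
  the mean value inequality for the norm; the lower one uses the monotonicity of
  \<open>Re (cnj e * f (t e)) + (1 - t)\<^sup>\<lambda>\<^sup>+\<^sup>1 / (\<lambda> + 1)\<close> in \<open>t\<close>, where \<open>e = z / \<bar>z\<bar>\<close>.
\<close>
lemma class_G_growth: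
  assumes lam: "0 < lam" "lam \<le> 1" and f: "f \<in> class_G lam" and z: "norm z < 1"
  shows "(1 - (1 - norm z) powr (lam + 1)) / (1 + lam) \<le> norm (f z)"
    and "norm (f z) \<le> ((1 + norm z) powr (lam + 1) - 1) / (1 + lam)"
proof -
  have hol: "f holomorphic_on \<bbbD>" and f0: "f 0 = 0"
    using f by (auto simp: class_G_def class_A_iff)
  define r where "r = norm z"
  have r: "0 \<le> r" "r < 1" using z by (auto simp: r_def)
  define e where "e = sgn z"
  have z_eq: "z = of_real r * e" by (simp add: r_def e_def sgn_eq)
  have "(1 - (1 - r) powr (lam + 1)) / (1 + lam) \<le> norm (f z) \<and>
        norm (f z) \<le> ((1 + r) powr (lam + 1) - 1) / (1 + lam)"
  proof (cases "r = 0")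
    case True
    then have "z = 0" by (simp add: r_def)
    with f0 True show ?thesis by simp
  next
    case False
    with r have r0: "0 < r" by simp
    have ne: "norm e = 1" using False by (simp add: e_def norm_sgn r_def)
    then have ce: "cnj e * e = 1" using complex_norm_square[of e] by (simp add: mult.commute)
    have nte: "norm (of_real t * e) = t" if "0 \<le> t" for t :: real using that ne by (simp add: norm_mult)
    define p where "p t = f (of_real t * e)" for t :: real
    define p' where "p' t = deriv f (of_real t * e) * e" for t :: real
    have dp: "(p has_vector_derivative p' t) (at t)" if "0 \<le> t" "t \<le> r" for t
    proof -
      have "(f has_field_derivative deriv f (of_real t * e)) (at (of_real t * e))"
        by (rule holomorphic_derivI[OF hol open_ball]) (use nte[of t] that r in simp)
      then have "((\<lambda>x. f (x * e)) has_field_derivative p' t) (at (of_real t))"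
        unfolding p'_def
        by (intro DERIV_chain2[where g = "\<lambda>x. x * e"]) (auto intro!: derivative_eq_intros)
      then show ?thesis unfolding p_def by (rule has_vector_derivative_real_field)
    qed
    have pr: "p r = f z" and p0: "p 0 = 0" by (auto simp: p_def z_eq f0)
    have "norm (p r - p 0) \<le> (1 + r) powr (lam + 1) / (lam + 1) - (1 + 0) powr (lam + 1) / (lam + 1)"
    proof (rule differentiable_bound_general[OF r0])
      show "continuous_on {0..r} p"
        by (intro continuous_at_imp_continuous_on ballI has_vector_derivative_continuous) (use dp in auto)
      show "continuous_on {0..r} (\<lambda>t. (1 + t) powr (lam + 1) / (lam + 1))"
        using lam by (intro continuous_intros) auto
      show "(p has_vector_derivative p' t) (at t)" if "0 < t" "t < r" for t using dp that by simp
      show "((\<lambda>t. (1 + t) powr (lam + 1) / (lam + 1)) has_vector_derivative (1 + t) powr lam) (at t)"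
        if "0 < t" for t
        using that lam by (auto intro!: derivative_eq_intros simp flip: has_real_derivative_iff_has_vector_derivative)
      show "norm (p' t) \<le> (1 + t) powr lam" if "0 < t" "t < r" for t
        using class_G_deriv_bounds(2)[OF lam f, of "of_real t * e"] nte[of t] that r ne
        by (simp add: p'_def norm_mult)
    qed
    moreover have "Re (cnj e * p 0) + (1 - 0) powr (lam + 1) / (lam + 1)
        \<le> Re (cnj e * p r) + (1 - r) powr (lam + 1) / (lam + 1)"
    proof (rule DERIV_nonneg_imp_nondecreasing[OF r(1)])
      fix t assume t: "0 \<le> t" "t \<le> r"
      have "((\<lambda>t. cnj e * p t) has_vector_derivative cnj e * p' t) (at t)"
        by (intro has_vector_derivative_mult_right dp t)
      then have "((\<lambda>t. Re (cnj e * p t)) has_real_derivative Re (cnj e * p' t)) (at t)"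
        by (rule has_field_derivative_Re)
      moreover have "((\<lambda>t. (1 - t) powr (lam + 1) / (lam + 1)) has_real_derivative - ((1 - t) powr lam)) (at t)"
        using t r lam by (auto intro!: derivative_eq_intros)
      ultimately have "((\<lambda>t. Re (cnj e * p t) + (1 - t) powr (lam + 1) / (lam + 1))
          has_real_derivative Re (cnj e * p' t) + - ((1 - t) powr lam)) (at t)"
        by (rule DERIV_add)
      moreover have "cnj e * p' t = deriv f (of_real t * e)"
        using ce by (simp add: p'_def mult.left_commute)
      ultimately show "\<exists>d. ((\<lambda>t. Re (cnj e * p t) + (1 - t) powr (lam + 1) / (lam + 1))
          has_real_derivative d) (at t) \<and> 0 \<le> d"
        using class_G_deriv_bounds(1)[OF lam f, of "of_real t * e"] nte[of t] t r by auto
    qed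
    moreover have "Re (cnj e * p r) \<le> norm (p r)"
      using complex_Re_le_cmod[of "cnj e * p r"] ne by (simp add: norm_mult)
    ultimately show ?thesis
      by (simp add: pr p0 diff_divide_distrib add.commute)
  qed
  then show "(1 - (1 - norm z) powr (lam + 1)) / (1 + lam) \<le> norm (f z)"
    and "norm (f z) \<le> ((1 + norm z) powr (lam + 1) - 1) / (1 + lam)"
    by (simp_all add: r_def)
qed

section \<open>The extremal function\<close>

lemma one_plus_disc: "z \<in> \<bbbD> \<Longrightarrow> 0 < Re (1 + z)" for z :: complex
  using one_minus_le_Re[of "1 + z" "norm z"] by simp

lemma deriv_G_F:
  assumes lam: "0 < lam" and z: "z \<in> \<bbbD>"
  shows "(G_F lam has_field_derivative (1 + z) powr complex_of_real lam) (at z)"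
proof -
  have nz: "complex_of_real lam + 1 \<noteq> 0"
    using lam by (metis add_pos_pos less_irrefl of_real_1 of_real_add of_real_eq_0_iff zero_less_one)
  have "1 + z \<notin> \<real>\<^sub>\<le>\<^sub>0" using one_plus_disc[OF z] by (auto simp: complex_nonpos_Reals_iff)
  then show ?thesis
    unfolding G_F_def using nz by (auto intro!: derivative_eq_intros simp: add.commute)
qed

text \<open>
  For the extremal function \<open>z f'' / f' = \<lambda> z / (1 + z)\<close>, and \<open>z / (1 + z)\<close> maps the disc into the
  half-plane \<open>Re < 1/2\<close>.
\<close>
lemma G_F_in_class_G:
  assumes lam: "0 < lam"
  shows "G_F lam \<in> class_G lam"
proof -
  have d1: "deriv (G_F lam) z = (1 + z) powr complex_of_real lam" if "z \<in> \<bbbD>" for z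
    by (rule DERIV_imp_deriv[OF deriv_G_F[OF lam that]])
  have nz: "1 + z \<noteq> 0" if "z \<in> \<bbbD>" for z using one_plus_disc[OF that] by (metis less_irrefl zero_complex.sel(1))
  have "Re (1 + z * deriv (deriv (G_F lam)) z / deriv (G_F lam) z) < 1 + lam / 2" if z: "z \<in> \<bbbD>" for z
  proof -
    have "1 + z \<notin> \<real>\<^sub>\<le>\<^sub>0" using one_plus_disc[OF z] by (auto simp: complex_nonpos_Reals_iff)
    then have "((\<lambda>z. (1 + z) powr complex_of_real lam) has_field_derivative
        of_real lam * (1 + z) powr (of_real lam - 1)) (at z)"
      by (auto intro!: derivative_eq_intros)
    then have "(deriv (G_F lam) has_field_derivative of_real lam * (1 + z) powr (of_real lam - 1)) (at z)"
      by (rule has_field_derivative_transform_within_open[OF _ open_ball z]) (simp add: d1)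
    then have "deriv (deriv (G_F lam)) z = of_real lam * ((1 + z) powr of_real lam / (1 + z))"
      using nz[OF z] by (simp add: DERIV_imp_deriv powr_diff)
    then have *: "z * deriv (deriv (G_F lam)) z / deriv (G_F lam) z = of_real lam * (z / (1 + z))"
      using nz[OF z] by (simp add: d1[OF z])
    have "Re (z / (1 + z)) < 1 / 2"
    proof -
      have "(Re z)\<^sup>2 + (Im z)\<^sup>2 < 1"
        using z by (simp add: cmod_power2[symmetric] power_less_one_iff)
      moreover have "0 < (1 + Re z)\<^sup>2 + (Im z)\<^sup>2"
        using one_plus_disc[OF z] by (simp add: add_pos_nonneg)
      ultimately show ?thesis
        by (simp add: Re_divide divide_less_eq) (simp add: power2_eq_square algebra_simps)
    qed
    then have "lam * Re (z / (1 + z)) < lam * (1 / 2)"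
      using lam by (intro mult_strict_left_mono)
    then show ?thesis
      by (simp only: * plus_complex.sel one_complex.sel times_complex.sel Re_complex_of_real
          Im_complex_of_real mult_zero_left diff_zero)
  qed
  moreover have "G_F lam holomorphic_on \<bbbD>"
    using deriv_G_F[OF lam] by (subst holomorphic_on_open) blast+
  moreover have "G_F lam 0 = 0" by (simp add: G_F_def)
  ultimately show ?thesis
    using nz unfolding class_G_def class_A_iff by (auto simp: d1)
qed

lemma G_F_of_real:
  assumes "-1 \<le> x"
  shows "G_F lam (of_real x) = of_real (((1 + x) powr (lam + 1) - 1) / (1 + lam))"
  using powr_of_real[of "1 + x" "1 + lam"] assms by (simp add: G_F_def add.commute)

text \<open>
  With \<open>\<alpha> = arcsin r\<close>, the point of contact of the tangent from 0 to the circle \<open>\<bar>u - 1\<bar> = r\<close> is the foot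
  \<open>cos \<alpha> (cos \<alpha> + i sin \<alpha>)\<close> of the perpendicular from 1 to the ray of angle \<open>\<alpha>\<close>.
\<close>
lemma arcsin_angle_attained:
  assumes r: "0 \<le> r" "r < 1"
  obtains \<zeta> where "norm \<zeta> = r" "Im (Ln (1 + \<zeta>)) = arcsin r"
proof
  define \<alpha> where "\<alpha> = arcsin r"
  define \<zeta> where "\<zeta> = of_real (cos \<alpha>) * cis \<alpha> - 1"
  have \<alpha>: "0 \<le> \<alpha>" "\<alpha> < pi / 2" "sin \<alpha> = r"
    using r arcsin_nonneg[of r] arcsin_lt_bounded[of r] by (auto simp: \<alpha>_def)
  have c: "0 < cos \<alpha>" using \<alpha> by (intro cos_gt_zero_pi) auto
  have "(norm \<zeta>)\<^sup>2 = (cos \<alpha> * cos \<alpha> - 1)\<^sup>2 + (cos \<alpha> * sin \<alpha>)\<^sup>2"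
    by (simp add: cmod_power2 \<zeta>_def)
  also have "\<dots> = (sin \<alpha>)\<^sup>2"
    using sin_cos_squared_add[of \<alpha>] by algebra
  finally show "norm \<zeta> = r" using \<alpha> r by (simp add: power2_eq_iff_nonneg)
  have "1 + \<zeta> = exp (of_real (ln (cos \<alpha>)) + \<i> * of_real \<alpha>)"
    using c by (simp add: \<zeta>_def exp_add cis_conv_exp exp_of_real)
  then show "Im (Ln (1 + \<zeta>)) = arcsin r"
    using \<alpha> by (simp add: Ln_exp \<alpha>_def)
qed

section \<open>Sharp bounds\<close>

theorem theorem3p13:
  fixes lam :: real
  assumes "0 < lam" and "lam \<le> 1"
  shows
    "(\<forall>f \<in> class_G lam. \<forall>(r::real) (z::complex). norm z = r \<and> r < 1 \<longrightarrow>
        (1 - r) powr lam \<le> norm (deriv f z) \<and> norm (deriv f z) \<le> (1 + r) powr lam \<and>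
        \<bar>arg_branch (deriv f) z\<bar> \<le> lam * arcsin r \<and>
        - G_F lam (- complex_of_real r) = complex_of_real ((1 - (1 - r) powr (lam + 1)) / (1 + lam)) \<and>
        (1 - (1 - r) powr (lam + 1)) / (1 + lam) \<le> norm (f z) \<and>
        norm (f z) \<le> ((1 + r) powr (lam + 1) - 1) / (1 + lam) \<and>
        complex_of_real (((1 + r) powr (lam + 1) - 1) / (1 + lam)) = G_F lam (complex_of_real r))
     \<and>
     G_F lam \<in> class_G lam
     \<and>
     (\<forall>\<mu>::complex. norm \<mu> = 1 \<longrightarrow>
        rotation \<mu> (G_F lam) \<in> class_G lam \<and>
        (\<forall>r::real. 0 \<le> r \<and> r < 1 \<longrightarrow>
          (\<exists>z. norm z = r \<and> norm (deriv (rotation \<mu> (G_F lam)) z) = (1 - r) powr lam) \<and>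
          (\<exists>z. norm z = r \<and> norm (deriv (rotation \<mu> (G_F lam)) z) = (1 + r) powr lam) \<and>
          (\<exists>z. norm z = r \<and> \<bar>arg_branch (deriv (rotation \<mu> (G_F lam))) z\<bar> = lam * arcsin r) \<and>
          (\<exists>z. norm z = r \<and> norm (rotation \<mu> (G_F lam) z) = (1 - (1 - r) powr (lam + 1)) / (1 + lam)) \<and>
          (\<exists>z. norm z = r \<and> norm (rotation \<mu> (G_F lam) z) = ((1 + r) powr (lam + 1) - 1) / (1 + lam))))"
proof (intro conjI ballI allI impI)
  fix f :: "complex \<Rightarrow> complex" and r :: real and z :: complex
  assume f: "f \<in> class_G lam" and rz: "norm z = r \<and> r < 1"
  then have z: "norm z < 1" and r: "r = norm z" "0 \<le> r" "r < 1" by auto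
  note bounds = class_G_deriv_bounds[OF assms f z]
  show "(1 - r) powr lam \<le> norm (deriv f z)"
    using bounds(1) complex_Re_le_cmod[of "deriv f z"] by (simp add: r(1))
  show "norm (deriv f z) \<le> (1 + r) powr lam" using bounds(2) by (simp add: r(1))
  show "\<bar>arg_branch (deriv f) z\<bar> \<le> lam * arcsin r" using bounds(3) by (simp add: r(1))
  show "(1 - (1 - r) powr (lam + 1)) / (1 + lam) \<le> norm (f z)"
    and "norm (f z) \<le> ((1 + r) powr (lam + 1) - 1) / (1 + lam)"
    using class_G_growth[OF assms f z] by (simp_all add: r(1))
  show "- G_F lam (- complex_of_real r) = complex_of_real ((1 - (1 - r) powr (lam + 1)) / (1 + lam))"
    using G_F_of_real[of "- r" lam] r(3) by (simp add: minus_divide_left)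
  show "complex_of_real (((1 + r) powr (lam + 1) - 1) / (1 + lam)) = G_F lam (complex_of_real r)"
    using G_F_of_real[of r lam] r(2) by simp
next
  show "G_F lam \<in> class_G lam" by (rule G_F_in_class_G[OF assms(1)])
next
  fix \<mu> :: complex assume \<mu>: "norm \<mu> = 1"
  show "rotation \<mu> (G_F lam) \<in> class_G lam"
    by (rule rotation_in_class_G(1)[OF G_F_in_class_G[OF assms(1)] \<mu>])
  have \<mu>\<mu>: "\<mu> * (cnj \<mu> * \<zeta>) = \<zeta>" for \<zeta>
    using \<mu> complex_norm_square[of \<mu>] by (simp flip: mult.assoc)
  have nrm: "norm (cnj \<mu> * \<zeta>) = norm \<zeta>" for \<zeta> using \<mu> by (simp add: norm_mult)
  have d: "deriv (rotation \<mu> (G_F lam)) z = (1 + \<mu> * z) powr complex_of_real lam" if "norm z < 1" for z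
    using rotation_in_class_G(2)[OF G_F_in_class_G[OF assms(1)] \<mu>, of z] that \<mu>
      DERIV_imp_deriv[OF deriv_G_F[OF assms(1), of "\<mu> * z"]] by (simp add: norm_mult)
  \<comment> \<open>At \<open>cnj \<mu> * x\<close> with \<open>x\<close> real, the rotated function has the moduli of the extremal function at \<open>x\<close>;
    \<open>x = r\<close> and \<open>x = - r\<close> give the upper and lower bounds.\<close>
  have ext: "norm (cnj \<mu> * complex_of_real x) = \<bar>x\<bar>"
    "norm (deriv (rotation \<mu> (G_F lam)) (cnj \<mu> * of_real x)) = (1 + x) powr lam"
    "norm (rotation \<mu> (G_F lam) (cnj \<mu> * of_real x)) = \<bar>((1 + x) powr (lam + 1) - 1) / (1 + lam)\<bar>"
    if "\<bar>x\<bar> < 1" for x :: real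
  proof -
    show n: "norm (cnj \<mu> * complex_of_real x) = \<bar>x\<bar>" by (simp add: nrm)
    have "norm (1 + complex_of_real x) = 1 + x"
      using that norm_of_real[of "1 + x", where 'a = complex] by simp
    then show "norm (deriv (rotation \<mu> (G_F lam)) (cnj \<mu> * of_real x)) = (1 + x) powr lam"
      using d[of "cnj \<mu> * of_real x"] n that by (simp add: \<mu>\<mu> norm_powr_real_powr')
    show "norm (rotation \<mu> (G_F lam) (cnj \<mu> * of_real x)) = \<bar>((1 + x) powr (lam + 1) - 1) / (1 + lam)\<bar>"
      using that \<mu> unfolding rotation_def norm_mult \<mu>\<mu> by (subst G_F_of_real) (auto simp del: of_real_divide)
  qed
  fix r :: real assume r: "0 \<le> r \<and> r < 1"
  show "\<exists>z. norm z = r \<and> norm (deriv (rotation \<mu> (G_F lam)) z) = (1 - r) powr lam"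
    using ext(1,2)[of "- r"] r by (intro exI[of _ "cnj \<mu> * of_real (- r)"]) simp
  show "\<exists>z. norm z = r \<and> norm (deriv (rotation \<mu> (G_F lam)) z) = (1 + r) powr lam"
    using ext(1,2)[of r] r by (intro exI[of _ "cnj \<mu> * of_real r"]) simp
  show "\<exists>z. norm z = r \<and> norm (rotation \<mu> (G_F lam) z) = (1 - (1 - r) powr (lam + 1)) / (1 + lam)"
  proof -
    have "(1 - r) powr (lam + 1) \<le> 1" using r assms by (intro powr_le1) auto
    then have "\<bar>((1 + - r) powr (lam + 1) - 1) / (1 + lam)\<bar> = (1 - (1 - r) powr (lam + 1)) / (1 + lam)"
      using assms by simp
    then show ?thesis
      using ext(1,3)[of "- r"] r by (intro exI[of _ "cnj \<mu> * of_real (- r)"]) simp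
  qed
  show "\<exists>z. norm z = r \<and> norm (rotation \<mu> (G_F lam) z) = ((1 + r) powr (lam + 1) - 1) / (1 + lam)"
  proof -
    have "1 \<le> (1 + r) powr (lam + 1)" using r assms by (intro ge_one_powr_ge_zero) auto
    then have "\<bar>((1 + r) powr (lam + 1) - 1) / (1 + lam)\<bar> = ((1 + r) powr (lam + 1) - 1) / (1 + lam)"
      using assms by simp
    then show ?thesis
      using ext(1,3)[of r] r by (intro exI[of _ "cnj \<mu> * of_real r"]) simp
  qed
  obtain \<zeta> where \<zeta>: "norm \<zeta> = r" "Im (Ln (1 + \<zeta>)) = arcsin r"
    using arcsin_angle_attained r by blast
  have "arg_branch (deriv (rotation \<mu> (G_F lam))) (cnj \<mu> * \<zeta>) = lam * Im (Ln (1 + \<mu> * (cnj \<mu> * \<zeta>)))"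
  proof (rule arg_branch_powr)
    show "continuous_on \<bbbD> (\<lambda>z. 1 + \<mu> * z)" by (intro continuous_intros)
    show "0 < Re (1 + \<mu> * z)" if "z \<in> \<bbbD>" for z
      using that \<mu> by (intro one_plus_disc) (simp add: norm_mult)
    show "cnj \<mu> * \<zeta> \<in> \<bbbD>" using nrm[of \<zeta>] \<zeta> r by simp
  qed (simp_all add: d)
  then have "\<bar>arg_branch (deriv (rotation \<mu> (G_F lam))) (cnj \<mu> * \<zeta>)\<bar> = lam * arcsin r"
    using arcsin_nonneg[of r] r assms by (simp add: \<mu>\<mu> \<zeta>(2) abs_mult)
  then show "\<exists>z. norm z = r \<and> \<bar>arg_branch (deriv (rotation \<mu> (G_F lam))) z\<bar> = lam * arcsin r"
    using nrm[of \<zeta>] \<zeta>(1) by blast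
qed

end
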